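(* Let $F$ be a non-abelian free group (of finite or infinite rank) with a basis $X$. Then the palindromic width of $F$ (with respect to the basis $X$) is infinite, i.e. for every natural number $k$ there is an element of $F$ that is not a product of at most $k$ palindromes in letters $X$.
   Context: Width: if $G$ is a group generated by a subset $S$, then for $g\in G$ the length $l_S(g)$ is the minimal $k$ such that $g$ is a product of $k$ elements of $S$; the width $\mathrm{wid}(G,S)$ is the supremum of $l_S(g)$ over $g\in G$ (a natural number or $\infty$). Palindromes: let $F$ be a free group with basis $X$. An element $w\in F$ is a palindrome in letters $X$ if its reduced word $w=x_{i_1}x_{i_2}\cdots x_{i_k}$ (with $x_{i_j}\in X^{\pm1}$ and $x_{i_j}x_{i_{j+1}}\neq 1$ for all $j$) satisfies $x_{i_1}x_{i_2}\cdots x_{i_k}=x_{i_k}\cdots x_{i_2}x_{i_1}$, i.e. the reduced word reads the same left-to-right and right-to-left as a word in letters from $X^{\pm 1}$. The palindromic width of $F$ is the width of $F$ with respect to the set of all palindromes in letters $X$ (this set contains $X$ and generates $F$). *)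

theory Defs
  imports "HOL-Algebra.Group" "HOL-Library.Extended_Nat"
begin

section \<open>Width of a group with respect to a subset\<close>

definition list_product :: "('a, 'b) monoid_scheme \<Rightarrow> 'a list \<Rightarrow> 'a" where
  "list_product G gs = foldr (\<otimes>\<^bsub>G\<^esub>) gs \<one>\<^bsub>G\<^esub>"

text \<open>Lengths take the value \<open>\<infinity>\<close> (the infimum of the empty set) on elements that are not
  products of elements of \<open>S\<close>.\<close>

definition set_length :: "('a, 'b) monoid_scheme \<Rightarrow> 'a set \<Rightarrow> 'a \<Rightarrow> enat" where
  "set_length G S g = (INF gs \<in> {gs \<in> lists S. list_product G gs = g}. enat (length gs))"

definition width :: "('a, 'b) monoid_scheme \<Rightarrow> 'a set \<Rightarrow> enat" where
  "width G S = (SUP g \<in> carrier G. set_length G S g)"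

section \<open>Free groups\<close>

text \<open>Letters are formal: \<open>(x, True)\<close> stands for \<open>x\<close> and \<open>(x, False)\<close> for its inverse. If the
  elements of \<open>X\<close> and their inverses in \<open>G\<close> were used instead, the group of order 2 would have
  unique normal forms over its generator.\<close>

type_synonym 'a letter = "'a \<times> bool"

definition words :: "'a set \<Rightarrow> 'a letter list set" where
  "words X = lists (X \<times> UNIV)"

fun inverse_letter :: "'a letter \<Rightarrow> 'a letter" where
  "inverse_letter (x, e) = (x, \<not> e)"

definition reduced :: "'a letter list \<Rightarrow> bool" where
  "reduced w \<longleftrightarrow> successively (\<lambda>a b. b \<noteq> inverse_letter a) w"

fun letter_value :: "('a, 'b) monoid_scheme \<Rightarrow> 'a letter \<Rightarrow> 'a" where
  "letter_value G (x, e) = (if e then x else inv\<^bsub>G\<^esub> x)"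

definition word_value :: "('a, 'b) monoid_scheme \<Rightarrow> 'a letter list \<Rightarrow> 'a" where
  "word_value G w = list_product G (map (letter_value G) w)"

text \<open>\<open>F\<close> is a free group with basis \<open>X\<close>: every element is the value of exactly one reduced word
  in the letters \<open>x, x\<inverse>\<close> with \<open>x \<in> X\<close>.\<close>

locale free_group = group F for F (structure) +
  fixes X :: "'a set"
  assumes basis_subset: "X \<subseteq> carrier F"
    and unique_reduced_word:
      "g \<in> carrier F \<Longrightarrow> \<exists>!w. w \<in> words X \<and> reduced w \<and> word_value F w = g"

definition reduced_word :: "('a, 'b) monoid_scheme \<Rightarrow> 'a set \<Rightarrow> 'a \<Rightarrow> 'a letter list" where
  "reduced_word F X g = (THE w. w \<in> words X \<and> reduced w \<and> word_value F w = g)"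

section \<open>Palindromes\<close>

definition palindromes :: "('a, 'b) monoid_scheme \<Rightarrow> 'a set \<Rightarrow> 'a set" where
  "palindromes F X = {g \<in> carrier F. rev (reduced_word F X g) = reduced_word F X g}"

definition palindromic_width :: "('a, 'b) monoid_scheme \<Rightarrow> 'a set \<Rightarrow> enat" where
  "palindromic_width F X = width F (palindromes F X)"

end

theory Submission
  imports Defs
begin

text \<open>
  For distinct \<open>x, y \<in> X\<close>, weigh the adjacent letters of a reduced word: \<open>xy\<close> and \<open>x\<inverse>y\<inverse>\<close> count
  \<open>+1\<close>, \<open>yx\<close> and \<open>y\<inverse>x\<inverse>\<close> count \<open>-1\<close>. The total weight changes sign under reversal, so it
  vanishes on palindromes, and it is invariant under inverting all letters, so it changes sign under
  inversion in \<open>F\<close>. Cancellation between two reduced words therefore costs nothing, and the weight is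
  a quasimorphism of defect at most 3, the error coming from three junctions. A product of \<open>k\<close>
  palindromes has weight at most \<open>3k\<close> in absolute value, while \<open>[x, y]\<^sup>n\<close> has weight \<open>2n\<close>.
\<close>

section \<open>Weights of adjacent pairs\<close>

fun adjacent_sum :: "('l \<Rightarrow> 'l \<Rightarrow> int) \<Rightarrow> 'l list \<Rightarrow> int" where
  "adjacent_sum \<phi> (a # b # w) = \<phi> a b + adjacent_sum \<phi> (b # w)"
| "adjacent_sum \<phi> w = 0"

lemma adjacent_sum_append_Cons:
  "adjacent_sum \<phi> (u @ a # v) = adjacent_sum \<phi> (u @ [a]) + adjacent_sum \<phi> (a # v)"
proof (induction u)
  case (Cons b u)
  then show ?case by (cases u) auto
qed simp

text \<open>The only adjacent pair of \<open>u @ v\<close> inside neither factor is the one at the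
  junction, and it exists only if both factors are nonempty.\<close>

lemma adjacent_sum_append:
  assumes "\<And>a b. \<bar>\<phi> a b\<bar> \<le> 1"
  shows "\<bar>adjacent_sum \<phi> (u @ v) - adjacent_sum \<phi> u - adjacent_sum \<phi> v\<bar> \<le> 1"
proof (cases u rule: rev_cases)
  case (snoc u' a)
  show ?thesis
  proof (cases v)
    case (Cons b v')
    then show ?thesis
      using snoc assms[of a b] adjacent_sum_append_Cons[of \<phi> u' a v] by simp
  qed simp
qed simp

lemma adjacent_sum_rev:
  assumes "\<And>a b. \<phi> b a = - \<phi> a b"
  shows "adjacent_sum \<phi> (rev w) = - adjacent_sum \<phi> w"
proof (induction w)
  case (Cons a w)
  show ?case
  proof (cases w)
    case (Cons b v)
    then show ?thesis
      using Cons.IH assms[of a b] adjacent_sum_append_Cons[of \<phi> "rev v" b "[a]"] by simp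
  qed simp
qed simp

lemma adjacent_sum_map:
  "adjacent_sum \<phi> (map h w) = adjacent_sum (\<lambda>a b. \<phi> (h a) (h b)) w"
  by (induction "\<lambda>a b. \<phi> (h a) (h b)" w rule: adjacent_sum.induct) auto

text \<open>Pairs with opposite exponents must weigh 0: if exponents were ignored, yx^-1 and y^-1x
  would count -1 and the weight of [x, y]^n would stay bounded.\<close>

definition pair_weight :: "'a \<Rightarrow> 'a \<Rightarrow> 'a letter \<Rightarrow> 'a letter \<Rightarrow> int" where
  "pair_weight x y a b =
    (if snd a \<noteq> snd b then 0
     else if fst a = x \<and> fst b = y then 1
     else if fst a = y \<and> fst b = x then - 1
     else 0)"

lemma abs_pair_weight_le: "\<bar>pair_weight x y a b\<bar> \<le> 1"
  by (simp add: pair_weight_def)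

lemma pair_weight_swap: "x \<noteq> y \<Longrightarrow> pair_weight x y b a = - pair_weight x y a b"
  by (auto simp: pair_weight_def)

lemma pair_weight_inverse_letter:
  "pair_weight x y (inverse_letter a) (inverse_letter b) = pair_weight x y a b"
  by (cases a; cases b) (simp add: pair_weight_def)

lemma adjacent_sum_pair_weight_rev:
  "x \<noteq> y \<Longrightarrow>
    adjacent_sum (pair_weight x y) (rev w) = - adjacent_sum (pair_weight x y) w"
  by (rule adjacent_sum_rev) (rule pair_weight_swap)

section \<open>Words\<close>

lemma inverse_letter_inverse_letter [simp]: "inverse_letter (inverse_letter a) = a"
  by (cases a) simp

definition inverse_word :: "'a letter list \<Rightarrow> 'a letter list" where
  "inverse_word w = rev (map inverse_letter w)"

lemma adjacent_sum_inverse_word: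
  "x \<noteq> y \<Longrightarrow>
    adjacent_sum (pair_weight x y) (inverse_word w) = - adjacent_sum (pair_weight x y) w"
  by (simp add: inverse_word_def adjacent_sum_pair_weight_rev adjacent_sum_map
      pair_weight_inverse_letter)

lemma Nil_in_words [simp]: "[] \<in> words X"
  by (simp add: words_def)

lemma words_Cons_iff [simp]: "a # w \<in> words X \<longleftrightarrow> fst a \<in> X \<and> w \<in> words X"
  by (simp add: words_def mem_Times_iff)

lemma words_append_iff [simp]: "u @ v \<in> words X \<longleftrightarrow> u \<in> words X \<and> v \<in> words X"
  by (simp add: words_def)

lemma fst_in_if_words: "w \<in> words X \<Longrightarrow> a \<in> set w \<Longrightarrow> fst a \<in> X"
  by (force simp: words_def)

text \<open>Here \<open>q\<close> is the part of \<open>u\<close> that cancels against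
  \<open>v\<close>. Letters are taken from the right end of \<open>u\<close>, with \<open>v\<close>
  shrinking from the left, until the junction is reduced.\<close>

lemma reduced_append_cancel:
  assumes "reduced u" "reduced v"
  obtains p q r where "u = p @ q" "v = inverse_word q @ r" "reduced (p @ r)"
  using assms
proof (induction u arbitrary: v thesis rule: rev_induct)
  case Nil
  then show ?case by (auto simp: inverse_word_def)
next
  case (snoc a u)
  show ?case
  proof (cases "reduced (u @ a # v)")
    case True
    then show ?thesis
      using snoc.prems(1)[of "u @ [a]" "[]" v] by (simp add: inverse_word_def)
  next
    case False
    \<comment> \<open>Both words are reduced, so reducedness can fail only at the junction.\<close>
    then obtain v' where v: "v = inverse_letter a # v'"
      using snoc.prems(2,3)
      by (cases v) (auto simp: reduced_def successively_append_iff)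
    have "reduced u" "reduced v'"
      using snoc.prems(2,3) v
      by (auto simp: reduced_def successively_append_iff successively_Cons)
    then obtain p q r where "u = p @ q" "v' = inverse_word q @ r" "reduced (p @ r)"
      using snoc.IH by blast
    then show ?thesis
      using snoc.prems(1)[of p "q @ [a]" r] v by (simp add: inverse_word_def)
  qed
qed

definition commutator_power_word :: "'a \<Rightarrow> 'a \<Rightarrow> nat \<Rightarrow> 'a letter list" where
  "commutator_power_word x y n =
    concat (replicate n [(x, True), (y, True), (x, False), (y, False)])"

lemma commutator_power_word_in_words:
  "x \<in> X \<Longrightarrow> y \<in> X \<Longrightarrow> commutator_power_word x y n \<in> words X"
  by (induction n) (auto simp: commutator_power_word_def)

lemma reduced_commutator_power_word:
  assumes "x \<noteq> y"
  shows "reduced (commutator_power_word x y n)"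
proof (induction n)
  case (Suc n)
  then show ?case
    using assms by (cases n) (auto simp: commutator_power_word_def reduced_def)
qed (simp add: commutator_power_word_def reduced_def)

text \<open>Each block contributes xy and x^-1y^-1. The pairs yx^-1 inside a block and y^-1x between
  blocks have mixed exponents and weigh 0.\<close>

lemma adjacent_sum_commutator_power_word:
  assumes "x \<noteq> y"
  shows "adjacent_sum (pair_weight x y) (commutator_power_word x y n) = 2 * int n"
proof (induction n)
  case (Suc n)
  then show ?case
    using assms by (cases n) (auto simp: commutator_power_word_def pair_weight_def)
qed (simp add: commutator_power_word_def)

section \<open>Free groups\<close>

context free_group
begin

lemma letter_value_closed: "fst a \<in> X \<Longrightarrow> letter_value F a \<in> carrier F"
  using basis_subset by (cases a) auto

lemma word_value_Nil [simp]: "word_value F [] = \<one>"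
  by (simp add: word_value_def list_product_def)

lemma word_value_Cons [simp]: "word_value F (a # w) = letter_value F a \<otimes> word_value F w"
  by (simp add: word_value_def list_product_def)

lemma word_value_closed: "w \<in> words X \<Longrightarrow> word_value F w \<in> carrier F"
  by (induction w) (auto simp: letter_value_closed)

lemma word_value_append:
  "u \<in> words X \<Longrightarrow> v \<in> words X \<Longrightarrow> word_value F (u @ v) = word_value F u \<otimes> word_value F v"
  by (induction u) (auto simp: m_assoc letter_value_closed word_value_closed)

lemma letter_value_inverse_letter:
  "fst a \<in> X \<Longrightarrow> letter_value F a \<otimes> letter_value F (inverse_letter a) = \<one>"
  using basis_subset by (cases a) auto

lemma word_value_cancel:
  assumes "q \<in> words X" "r \<in> words X"
  shows "word_value F (q @ inverse_word q @ r) = word_value F r"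
  using assms
proof (induction q arbitrary: r)
  case (Cons a q)
  have a: "fst a \<in> X" "fst (inverse_letter a) \<in> X" and q: "q \<in> words X"
    using Cons.prems by (cases a; simp)+
  \<comment> \<open>The inverse of the first letter of the word ends up next to \<open>r\<close>, so
    the induction hypothesis is applied with this longer tail.\<close>
  have r: "inverse_letter a # r \<in> words X"
    using Cons.prems a by simp
  have "word_value F (a # q @ inverse_word q @ inverse_letter a # r) =
      letter_value F a \<otimes> (letter_value F (inverse_letter a) \<otimes> word_value F r)"
    using Cons.IH[OF q r] by simp
  also have "\<dots> = word_value F r"
    using a Cons.prems
    by (simp add: m_assoc[symmetric] letter_value_closed word_value_closed
        letter_value_inverse_letter)
  finally show ?case
    by (simp add: inverse_word_def)
qed (simp add: inverse_word_def)

section \<open>Normal forms and products\<close>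

lemma reduced_word:
  assumes "g \<in> carrier F"
  shows "reduced_word F X g \<in> words X" "reduced (reduced_word F X g)"
    "word_value F (reduced_word F X g) = g"
  using theI'[OF unique_reduced_word[OF assms]] by (auto simp: reduced_word_def)

lemma reduced_word_word_value:
  assumes "w \<in> words X" "reduced w"
  shows "reduced_word F X (word_value F w) = w"
  using reduced_word[OF word_value_closed] unique_reduced_word[OF word_value_closed] assms
  by blast

text \<open>Cancelling \<open>q\<close> leaves the value unchanged, and \<open>p @ r\<close> is
  reduced, so uniqueness makes it the normal form of the product.\<close>

lemma reduced_word_mult:
  assumes "g \<in> carrier F" "h \<in> carrier F"
  obtains p q r where "reduced_word F X g = p @ q" "reduced_word F X h = inverse_word q @ r"
    "reduced_word F X (g \<otimes> h) = p @ r"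
proof -
  obtain p q r where g: "reduced_word F X g = p @ q"
    and h: "reduced_word F X h = inverse_word q @ r" and red: "reduced (p @ r)"
    using reduced_append_cancel assms reduced_word(2) by metis
  have w: "p \<in> words X" "q \<in> words X" "inverse_word q \<in> words X" "r \<in> words X"
    using reduced_word(1)[OF assms(1)] reduced_word(1)[OF assms(2)] by (simp_all add: g h)
  have "g \<otimes> h = word_value F (p @ q) \<otimes> word_value F (inverse_word q @ r)"
    using reduced_word(3) assms g h by metis
  also have "\<dots> = word_value F p \<otimes> word_value F (q @ inverse_word q @ r)"
    using w by (simp add: word_value_append m_assoc word_value_closed)
  also have "\<dots> = word_value F (p @ r)"
    using w by (simp only: word_value_cancel word_value_append)
  finally have "reduced_word F X (g \<otimes> h) = p @ r"
    using reduced_word_word_value w red by simp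
  with g h show ?thesis by (rule that)
qed

section \<open>The weight as a quasimorphism\<close>

definition weight :: "'a \<Rightarrow> 'a \<Rightarrow> 'a \<Rightarrow> int" where
  "weight x y g = adjacent_sum (pair_weight x y) (reduced_word F X g)"

text \<open>The weights of \<open>q\<close> and \<open>inverse_word q\<close> cancel. What remains
  is an error of at most 1 at each of the junctions of \<open>p\<close> with \<open>q\<close>,
  \<open>inverse_word q\<close> with \<open>r\<close>, and \<open>p\<close> with
  \<open>r\<close>.\<close>

lemma weight_mult:
  assumes "x \<noteq> y" "g \<in> carrier F" "h \<in> carrier F"
  shows "\<bar>weight x y (g \<otimes> h) - weight x y g - weight x y h\<bar> \<le> 3"
proof -
  obtain p q r where *: "reduced_word F X g = p @ q" "reduced_word F X h = inverse_word q @ r"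
    "reduced_word F X (g \<otimes> h) = p @ r"
    using reduced_word_mult assms by blast
  show ?thesis
    using adjacent_sum_append[of "pair_weight x y" p q, OF abs_pair_weight_le]
      adjacent_sum_append[of "pair_weight x y" "inverse_word q" r, OF abs_pair_weight_le]
      adjacent_sum_append[of "pair_weight x y" p r, OF abs_pair_weight_le]
      adjacent_sum_inverse_word[OF assms(1), of q]
    unfolding weight_def * by linarith
qed

lemma weight_palindrome:
  assumes "x \<noteq> y" "g \<in> palindromes F X"
  shows "weight x y g = 0"
  using adjacent_sum_pair_weight_rev[OF assms(1), of "reduced_word F X g"] assms(2)
  by (simp add: weight_def palindromes_def)

text \<open>Each further palindrome has weight 0 and costs only the defect 3. Membership in the
  carrier is carried through the induction because \<open>weight_mult\<close> requires it.\<close>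

lemma weight_product_palindromes:
  assumes "x \<noteq> y" "set ps \<subseteq> palindromes F X"
  shows "list_product F ps \<in> carrier F \<and>
    \<bar>weight x y (list_product F ps)\<bar> \<le> 3 * int (length ps)"
  using assms(2)
proof (induction ps)
  case Nil
  have "reduced_word F X \<one> = []"
    using reduced_word_word_value[of "[]"] by (simp add: reduced_def)
  then show ?case
    by (simp add: list_product_def weight_def)
next
  case (Cons p ps)
  have p: "p \<in> carrier F" "weight x y p = 0"
    using Cons.prems weight_palindrome assms(1) by (auto simp: palindromes_def)
  have "list_product F (p # ps) = p \<otimes> list_product F ps"
    by (simp add: list_product_def)
  then show ?case
    using Cons p weight_mult[OF assms(1) p(1), of "list_product F ps"] by auto
qed

section \<open>A non-abelian free group has two basis elements\<close>

lemma commutes_word_value: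
  assumes "c \<in> carrier F" "w \<in> words X"
    and "\<And>a. a \<in> set w \<Longrightarrow> c \<otimes> letter_value F a = letter_value F a \<otimes> c"
  shows "c \<otimes> word_value F w = word_value F w \<otimes> c"
  using assms(2,3)
proof (induction w)
  case (Cons a w)
  have cl: "letter_value F a \<in> carrier F" "word_value F w \<in> carrier F"
    using Cons.prems letter_value_closed word_value_closed by auto
  have IH: "c \<otimes> word_value F w = word_value F w \<otimes> c"
    using Cons by simp
  have "c \<otimes> (letter_value F a \<otimes> word_value F w) = letter_value F a \<otimes> (c \<otimes> word_value F w)"
    using Cons.prems(2)[of a] cl assms(1) by (simp add: m_assoc[symmetric])
  then show ?case
    using IH cl assms(1) by (simp add: m_assoc)
qed (simp add: assms(1))

text \<open>Any two letters are powers of the same basis element, hence commute.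
  \<open>commutes_word_value\<close> lifts this first to a letter against an element, then to two
  elements. The contrapositive supplies the distinct \<open>x\<close> and \<open>y\<close> that the
  weight needs.\<close>

lemma comm_group_if_basis_trivial:
  assumes "\<And>x y. x \<in> X \<Longrightarrow> y \<in> X \<Longrightarrow> x = y"
  shows "comm_group F"
proof (rule group_comm_groupI)
  have letters: "letter_value F a \<otimes> letter_value F b = letter_value F b \<otimes> letter_value F a"
    if "fst a \<in> X" "fst b \<in> X" for a b
    using that assms[OF that] basis_subset by (cases a; cases b) auto
  fix g h assume gh: "g \<in> carrier F" "h \<in> carrier F"
  have "h \<otimes> letter_value F a = letter_value F a \<otimes> h" if a: "fst a \<in> X" for a
    using commutes_word_value[OF letter_value_closed[OF a] reduced_word(1)[OF gh(2)]]
      letters[OF a] fst_in_if_words[OF reduced_word(1)[OF gh(2)]] reduced_word(3)[OF gh(2)]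
    by simp
  then show "g \<otimes> h = h \<otimes> g"
    using commutes_word_value[OF gh(2) reduced_word(1)[OF gh(1)]]
      fst_in_if_words[OF reduced_word(1)[OF gh(1)]] reduced_word(3)[OF gh(1)]
    by simp
qed

end

section \<open>Infinite palindromic width\<close>

lemma width_eq_infinity:
  assumes "\<And>k. \<exists>g \<in> carrier G.
    \<not> (\<exists>gs. set gs \<subseteq> S \<and> length gs \<le> k \<and> list_product G gs = g)"
  shows "width G S = \<infinity>"
proof -
  have "enat k \<le> width G S" for k
  proof -
    obtain g where g: "g \<in> carrier G"
      and no: "\<not> (\<exists>gs. set gs \<subseteq> S \<and> length gs \<le> k \<and> list_product G gs = g)"
      using assms by blast
    have "enat k \<le> set_length G S g"
      unfolding set_length_def
    \<comment> \<open>A lower bound on every factorization suffices, even if there is none: the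
      infimum is then \<infinity>.\<close>
    proof (rule INF_greatest)
      fix gs assume "gs \<in> {gs \<in> lists S. list_product G gs = g}"
      then have "\<not> length gs \<le> k"
        using no by (auto simp: lists_eq_set)
      then show "enat k \<le> enat (length gs)" by simp
    qed
    also have "\<dots> \<le> width G S"
      unfolding width_def using g by (rule SUP_upper)
    finally show ?thesis .
  qed
  \<comment> \<open>A finite width \<open>m\<close> would satisfy
    \<open>Suc m \<le> m\<close>.\<close>
  then show ?thesis
    by (metis enat_ord_simps(1) not_enat_eq not_less_eq_eq order_refl)
qed

theorem theorem1p1:
  fixes F :: "('a, 'b) monoid_scheme" and X :: "'a set"
  assumes "free_group F X"
    and "\<not> comm_group F"
  shows "palindromic_width F X = \<infinity> \<and>
    (\<forall>k. \<exists>g \<in> carrier F.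
      \<not> (\<exists>ps. set ps \<subseteq> palindromes F X \<and> length ps \<le> k \<and> list_product F ps = g))"
proof -
  interpret free_group F X by fact
  obtain x y where xy: "x \<in> X" "y \<in> X" "x \<noteq> y"
    using comm_group_if_basis_trivial assms(2) by blast
  have long: "\<exists>g \<in> carrier F.
      \<not> (\<exists>ps. set ps \<subseteq> palindromes F X \<and> length ps \<le> k \<and> list_product F ps = g)" for k
  proof -
    \<comment> \<open>The weight 2(2k + 1) = 4k + 2 exceeds the bound 3k for every \<open>k\<close>;
      the extra 1 in the exponent covers k = 0.\<close>
    define w where "w = commutator_power_word x y (2 * k + 1)"
    have w: "w \<in> words X" "reduced w"
      using xy by (simp_all add: w_def commutator_power_word_in_words reduced_commutator_power_word)
    then have "weight x y (word_value F w) = 4 * int k + 2"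
      using xy(3) by (simp add: weight_def reduced_word_word_value w_def
          adjacent_sum_commutator_power_word)
    then have "\<not> (set ps \<subseteq> palindromes F X \<and> length ps \<le> k \<and> list_product F ps = word_value F w)"
      for ps
      using weight_product_palindromes[OF xy(3), of ps] by auto
    then show ?thesis
      using word_value_closed[OF w(1)] by blast
  qed
  then show ?thesis
    by (simp add: palindromic_width_def width_eq_infinity)
qed

end
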